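(* Consider a platoon of a leader (vehicle $0$) moving at constant speed and $N$ heterogeneous followers. For follower $i\in\{1,\dots,N\}$ let $\tau_i>0$ be its inertial time lag, $k_i=[k_{ip},k_{iv},k_{ia}]^T\in\mathbb{R}^3$ its feedback gain, and $c_p,c_v,c_a\in\{0,1\}$ the measurement indicators. Define $$t_{ip}=\tfrac{1}{\tau_i}k_{ip}c_p,\qquad t_{iv}=\tfrac{1}{\tau_i}k_{iv}c_v,\qquad t_{ia}=\tfrac{1}{\tau_i}k_{ia}c_a,$$ the diagonal matrices $\Delta=\mathrm{diag}\{1/\tau_1,\dots,1/\tau_N\}$, $T_\sharp=\mathrm{diag}\{t_{1\sharp},\dots,t_{N\sharp}\}$ for $\sharp\in\{p,v,a\}$, and $G=\mathcal{L}+\mathcal{P}$. Consider the closed-loop system of tracking errors $\hat p,\hat v,\hat a\in\mathbb{R}^N$: $$\begin{bmatrix}\dot{\hat p}\\ \dot{\hat v}\\ \dot{\hat a}\end{bmatrix}=\begin{bmatrix}0&I_N&0\\0&0&I_N\\-T_pG&-T_vG&-\Delta-T_aG\end{bmatrix}\begin{bmatrix}\hat p\\ \hat v\\ \hat a\end{bmatrix}.$$ If the information flow topology among the followers is a directed acyclic graph, then this system is asymptotically stable if and only if all of the following hold: (1) $c_p=c_v=1$; (2) $d_{ii}+p_{ii}>0$ for every $i\in\{1,\dots,N\}$; (3) for every $i\in\{1,\dots,N\}$, $$k_{ip}>0,\qquad k_{iv}>\frac{\tau_ik_{ip}}{1+k_{ia}c_a(d_{ii}+p_{ii})},\qquad 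k_{ia}c_a>-\frac{1}{d_{ii}+p_{ii}}.$$
   Context: The information flow among followers is a directed graph on $\{1,\dots,N\}$ with adjacency matrix $\mathcal{A}=[a_{ij}]$, $a_{ij}=1$ if follower $i$ receives information from follower $j$, else $0$, and $a_{ii}=0$. The degree matrix is $\mathcal{D}=\mathrm{diag}\{d_{11},\dots,d_{NN}\}$ with $d_{ii}=\sum_{k=1}^N a_{ik}$, and the Laplacian is $\mathcal{L}=\mathcal{D}-\mathcal{A}$. The pinning matrix is $\mathcal{P}=\mathrm{diag}\{p_{11},\dots,p_{NN}\}$ with $p_{ii}=1$ if follower $i$ receives information from the leader, else $0$. A directed acyclic graph is a finite directed graph with no directed cycles. (Physically, $\hat p_i=p_i-p_0+id_0$, $\hat v_i=v_i-v_0$, $\hat a_i=a_i$ are the tracking errors of follower $i$ with dynamics $\dot p_i=v_i$, $\dot v_i=a_i$, $\tau_i\dot a_i+a_i=u_i$ under the controller $u_i=-k_i^T(\sum_j a_{ij}(\hat y_i-\hat y_j)+p_{ii}\hat y_i)$, $\hat y_i=\mathrm{diag}\{c_p,c_v,c_a\}[\hat p_i,\hat v_i,\hat a_i]^T$.) *)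

theory Defs
  imports "HOL-Analysis.Analysis"
begin

text \<open>Followers are indexed by a finite type 'n (so N = CARD('n)).
  adjacency matrix am i j = a_ij in {0,1}; pinning pm i = p_ii in {0,1}.\<close>

definition deg :: "('n::finite \<Rightarrow> 'n \<Rightarrow> real) \<Rightarrow> 'n \<Rightarrow> real" where
  "deg am i = (\<Sum>k\<in>UNIV. am i k)"

text \<open>(G x)_i where G = L + P, i.e. sum_j a_ij (x_i - x_j) + p_ii x_i.\<close>
definition Gmul :: "('n::finite \<Rightarrow> 'n \<Rightarrow> real) \<Rightarrow> ('n \<Rightarrow> real) \<Rightarrow> real^'n \<Rightarrow> real^'n" where
  "Gmul am pm x = (\<chi> i. (\<Sum>j\<in>UNIV. am i j * (x$i - x$j)) + pm i * x$i)"

definition is_solution ::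
  "('n::finite \<Rightarrow> real) \<Rightarrow> ('n \<Rightarrow> real) \<Rightarrow> ('n \<Rightarrow> real) \<Rightarrow> ('n \<Rightarrow> real) \<Rightarrow>
   real \<Rightarrow> real \<Rightarrow> real \<Rightarrow> ('n \<Rightarrow> 'n \<Rightarrow> real) \<Rightarrow> ('n \<Rightarrow> real) \<Rightarrow>
   (real \<Rightarrow> real^'n) \<Rightarrow> (real \<Rightarrow> real^'n) \<Rightarrow> (real \<Rightarrow> real^'n) \<Rightarrow> bool" where
  "is_solution tau kp kv ka cp cv ca am pm p v a \<longleftrightarrow>
     (\<forall>t\<ge>0.
        (p has_vector_derivative v t) (at t within {0..}) \<and>
        (v has_vector_derivative a t) (at t within {0..}) \<and>
        (a has_vector_derivative
           (\<chi> i. - (kp i * cp / tau i) * (Gmul am pm (p t))$i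
                 - (kv i * cv / tau i) * (Gmul am pm (v t))$i
                 - (1 / tau i) * (a t)$i
                 - (ka i * ca / tau i) * (Gmul am pm (a t))$i))
          (at t within {0..}))"

definition asymptotically_stable ::
  "('n::finite \<Rightarrow> real) \<Rightarrow> ('n \<Rightarrow> real) \<Rightarrow> ('n \<Rightarrow> real) \<Rightarrow> ('n \<Rightarrow> real) \<Rightarrow>
   real \<Rightarrow> real \<Rightarrow> real \<Rightarrow> ('n \<Rightarrow> 'n \<Rightarrow> real) \<Rightarrow> ('n \<Rightarrow> real) \<Rightarrow> bool" where
  "asymptotically_stable tau kp kv ka cp cv ca am pm \<longleftrightarrow>
     (\<forall>e>0. \<exists>d>0. \<forall>p v a. is_solution tau kp kv ka cp cv ca am pm p v a \<longrightarrow>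
         norm (p 0, v 0, a 0) < d \<longrightarrow> (\<forall>t\<ge>0. norm (p t, v t, a t) < e)) \<and>
     (\<forall>p v a. is_solution tau kp kv ka cp cv ca am pm p v a \<longrightarrow>
         ((\<lambda>t. (p t, v t, a t)) \<longlongrightarrow> 0) at_top)"

end

theory Submission
  imports Defs
begin

text \<open>Acyclicity makes the closed loop block triangular: follower \<open>i\<close>, driven by its in-neighbours,
  obeys a third-order equation with characteristic polynomial
  \<open>s ^ 3 + (1 + k_ia c_a g) / \<tau> s ^ 2 + k_iv c_v g / \<tau> s + k_ip c_p g / \<tau>\<close>, where \<open>g = d_ii + p_ii\<close>.
  The gain conditions are the Routh--Hurwitz conditions for these cubics. If they all hold, each
  cubic splits into three stable first-order complex equations, and exponential decay
  propagates along the graph. If one fails, a root \<open>\<rho>\<close> with \<open>Re \<rho> \<ge> 0\<close>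
  yields an eigenmode of the whole system that does not tend to \<open>0\<close>.\<close>

subsection \<open>Roots of real cubics\<close>

text \<open>For large arguments the cubic term outweighs the others, so the values at the ends of a
  large symmetric interval have opposite signs and the intermediate value theorem applies.\<close>

lemma real_cubic_has_root:
  fixes a b c :: real
  obtains x where "x^3 + a * x^2 + b * x + c = 0"
proof -
  \<comment> \<open>For this \<open>M\<close> the lower-order terms at \<plusminus>\<open>M\<close>
    are at most \<open>(M - 1) * M^2\<close>, strictly below \<open>M^3\<close>.\<close>
  define M where "M = 1 + \<bar>a\<bar> + \<bar>b\<bar> + \<bar>c\<bar>"
  have M1: "M \<ge> 1" by (simp add: M_def)
  then have M2: "M^2 \<ge> M" "M^2 \<ge> 1" by (simp_all add: self_le_power one_le_power)
  have bound: "\<bar>a * x^2 + b * x + c\<bar> < M^3" if "\<bar>x\<bar> = M" for x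
  proof -
    have "\<bar>a * x^2\<bar> = \<bar>a\<bar> * M^2" "\<bar>b * x\<bar> = \<bar>b\<bar> * M"
      by (simp_all add: abs_mult flip: that)
    then have "\<bar>a * x^2 + b * x + c\<bar> \<le> \<bar>a\<bar> * M^2 + \<bar>b\<bar> * M + \<bar>c\<bar>"
      by linarith
    also have "\<dots> \<le> \<bar>a\<bar> * M^2 + \<bar>b\<bar> * M^2 + \<bar>c\<bar> * M^2"
      using M2 mult_left_mono[OF M2(1), of "\<bar>b\<bar>"] mult_left_mono[OF M2(2), of "\<bar>c\<bar>"] by simp
    also have "\<dots> = (M - 1) * M^2" unfolding M_def by (simp add: algebra_simps)
    also have "\<dots> = M^3 - M^2" by (simp add: left_diff_distrib power2_eq_square power3_eq_cube)
    also have "\<dots> < M^3" using M1 by simp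
    finally show ?thesis .
  qed
  have "\<exists>x. -M \<le> x \<and> x \<le> M \<and> x^3 + a * x^2 + b * x + c = 0"
  proof (rule IVT')
    show "(- M)^3 + a * (- M)^2 + b * (- M) + c \<le> 0" using bound[of "-M"] M1 by simp
    show "0 \<le> M^3 + a * M^2 + b * M + c" using bound[of "M"] M1 by simp
    show "continuous_on {-M..M} (\<lambda>x. x^3 + a * x^2 + b * x + c)" by (intro continuous_intros)
  qed (use M1 in simp)
  then show ?thesis using that by blast
qed

text \<open>The principal square root \<open>w\<close> of the discriminant has nonnegative real
  part, so \<open>x\<close> is the rightmost root and both roots are stable exactly when
  \<open>Re w < p\<close>.\<close>

lemma quadratic_roots_Re_neg:
  fixes p q :: real
  obtains x y :: complex
  where "x + y = - of_real p" "x * y = of_real q"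
    "Re x < 0 \<and> Re y < 0 \<longleftrightarrow> p > 0 \<and> q > 0"
proof -
  define w where "w = csqrt (of_real (p^2 - 4 * q))"
  define x where "x = (- of_real p + w) / 2"
  define y where "y = (- of_real p - w) / 2"
  have w2: "w^2 = of_real (p^2 - 4 * q)" unfolding w_def by simp
  have sum: "x + y = - of_real p" by (simp add: x_def y_def field_simps)
  have prod: "x * y = of_real q"
  proof -
    have "x * y = (of_real p ^ 2 - w^2) / 4"
      unfolding x_def y_def by (simp add: field_simps power2_eq_square)
    then show ?thesis using w2 by simp
  qed
  \<comment> \<open>\<open>w\<close> is real for a nonnegative discriminant and purely imaginary
    otherwise, so one formula covers real and conjugate roots.\<close>
  have Rew: "Re w = (if p^2 - 4 * q \<ge> 0 then sqrt (p^2 - 4 * q) else 0)"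
    unfolding w_def csqrt_of_real' by (simp del: of_real_diff)
  have Rex: "Re x = (Re w - p) / 2" and Rey: "Re y = (- p - Re w) / 2"
    by (simp_all add: x_def y_def)
  have "Re w \<ge> 0" using Rew by simp
  have "Re x < 0 \<and> Re y < 0 \<longleftrightarrow> Re w < p" using \<open>Re w \<ge> 0\<close> Rex Rey by auto
  also have "\<dots> \<longleftrightarrow> p > 0 \<and> q > 0"
  proof
    assume l: "Re w < p"
    with \<open>Re w \<ge> 0\<close> have p: "p > 0" by linarith
    have "q > 0"
    proof (cases "p^2 - 4 * q \<ge> 0")
      case True
      with l Rew have "sqrt (p^2 - 4 * q) < sqrt (p^2)" using p by simp
      then show ?thesis by (simp only: real_sqrt_less_iff)
    next
      case False
      then show ?thesis using zero_le_power2[of p] by linarith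
    qed
    with p show "p > 0 \<and> q > 0" by simp
  next
    assume r: "p > 0 \<and> q > 0"
    then have "sqrt (p^2 - 4 * q) < sqrt (p^2)" by (intro real_sqrt_less_mono) simp
    also have "sqrt (p^2) = p" using r by simp
    finally show "Re w < p" unfolding Rew using r by (simp split: if_split)
  qed
  finally show ?thesis using that sum prod by blast
qed

text \<open>A real root \<open>- r\<close> splits the cubic into
  \<open>(s + r) * (s^2 + p * s + q)\<close>. Stability then means that \<open>r\<close>,
  \<open>p\<close> and \<open>q\<close> are positive, and the identity
  \<open>a * b - c = p * (q + r * a)\<close> translates this into the Routh--Hurwitz
  inequalities.\<close>

lemma cubic_roots_Routh_Hurwitz:
  fixes a b c :: real
  obtains x y z :: complex
  where "of_real a = - (x + y + z)" "of_real b = x * y + y * z + z * x" "of_real c = - (x * y * z)"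
    "Re x < 0 \<and> Re y < 0 \<and> Re z < 0 \<longleftrightarrow> a > 0 \<and> c > 0 \<and> a * b > c"
proof -
  obtain x0 where x0: "x0^3 + a * x0^2 + b * x0 + c = 0" by (rule real_cubic_has_root)
  define r where "r = - x0"
  define p where "p = a - r"
  define q where "q = b - r * p"
  have a: "a = r + p" and b: "b = q + r * p" by (simp_all add: p_def q_def)
  have c: "c = r * q"
    using x0 unfolding p_def q_def r_def
    by (simp add: algebra_simps power2_eq_square power3_eq_cube)
  obtain y z :: complex where yz: "y + z = - of_real p" "y * z = of_real q"
    "Re y < 0 \<and> Re z < 0 \<longleftrightarrow> p > 0 \<and> q > 0"
    by (rule quadratic_roots_Re_neg)
  have disc: "a * b - c = p * (q + r * a)" unfolding a b c by (simp add: algebra_simps)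
  have equiv: "r > 0 \<and> p > 0 \<and> q > 0 \<longleftrightarrow> a > 0 \<and> c > 0 \<and> a * b > c"
  proof
    assume h: "r > 0 \<and> p > 0 \<and> q > 0"
    then have "a > 0" "c > 0" by (simp_all add: a c)
    moreover have "p * (q + r * a) > 0" using h \<open>a > 0\<close> by (intro mult_pos_pos add_pos_pos) auto
    ultimately show "a > 0 \<and> c > 0 \<and> a * b > c" using disc by simp
  next
    assume h: "a > 0 \<and> c > 0 \<and> a * b > c"
    then have "a * b > 0" by linarith
    with h have bpos: "b > 0" using zero_less_mult_pos by blast
    \<comment> \<open>When all coefficients are positive, no nonnegative number is a root.\<close>
    have "r > 0"
    proof (rule ccontr)
      assume "\<not> r > 0"
      then have "x0 \<ge> 0" by (simp add: r_def)
      then have "x0^3 + a * x0^2 + b * x0 \<ge> 0" using h bpos by simp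
      then show False using x0 h by linarith
    qed
    moreover from this have "q > 0" using h c zero_less_mult_pos by blast
    moreover have "q + r * a > 0" using calculation h by (simp add: add_pos_pos)
    then have "p > 0" using disc h zero_less_mult_pos2[of p "q + r * a"] by simp
    ultimately show "r > 0 \<and> p > 0 \<and> q > 0" by blast
  qed
  have p': "of_real p = - (y + z)" using yz(1) by simp
  show ?thesis
  proof (rule that[of "- of_real r" y z])
    show "of_real a = - (- of_real r + y + z)" by (simp add: a p')
    show "of_real b = - of_real r * y + y * z + z * (- of_real r)"
      by (simp add: b p' flip: yz(2)) (simp add: algebra_simps)
    show "of_real c = - (- of_real r * y * z)" by (simp add: c flip: yz(2))
    show "Re (- of_real r) < 0 \<and> Re y < 0 \<and> Re z < 0 \<longleftrightarrow> a > 0 \<and> c > 0 \<and> a * b > c"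
      using yz(3) equiv by auto
  qed
qed

subsection \<open>Exponential decay, uniform over a family of functions\<close>

text \<open>\<open>C\<close> and \<open>\<nu>\<close> are chosen before \<open>s\<close> and so
  serve the whole family. With the solutions as family and the size of the initial state as
  \<open>m\<close>, Lyapunov stability and attractivity follow together.\<close>

definition exp_decay :: "'s set \<Rightarrow> ('s \<Rightarrow> real) \<Rightarrow> ('s \<Rightarrow> real \<Rightarrow> 'a::real_normed_vector) \<Rightarrow> bool" where
  "exp_decay S m f \<longleftrightarrow>
     (\<exists>C \<nu>. 0 \<le> C \<and> 0 < \<nu> \<and> (\<forall>s\<in>S. \<forall>t\<ge>0. norm (f s t) \<le> C * exp (- \<nu> * t) * m s))"

lemma exp_decayI:
  assumes "0 \<le> C" "0 < \<nu>" "\<And>s t. s \<in> S \<Longrightarrow> 0 \<le> t \<Longrightarrow> norm (f s t) \<le> C * exp (- \<nu> * t) * m s"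
  shows "exp_decay S m f"
  unfolding exp_decay_def using assms by blast

text \<open>Lowering the rate only weakens the bound, so it can be kept below any competing rate
  \<open>\<mu>\<close>.\<close>

lemma exp_decayE:
  assumes "exp_decay S m f" "\<And>s. s \<in> S \<Longrightarrow> 0 \<le> m s" "0 < \<mu>"
  obtains C \<nu> where "0 \<le> C" "0 < \<nu>" "\<nu> \<le> \<mu>"
    "\<And>s t. s \<in> S \<Longrightarrow> 0 \<le> t \<Longrightarrow> norm (f s t) \<le> C * exp (- \<nu> * t) * m s"
proof -
  obtain C \<nu> where C: "0 \<le> C" "0 < \<nu>"
    "\<And>s t. s \<in> S \<Longrightarrow> 0 \<le> t \<Longrightarrow> norm (f s t) \<le> C * exp (- \<nu> * t) * m s"
    using assms(1) unfolding exp_decay_def by blast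
  have "norm (f s t) \<le> C * exp (- min \<nu> \<mu> * t) * m s" if "s \<in> S" "0 \<le> t" for s t
    using C(3)[OF that] assms(2)[OF that(1)] C(1) that(2)
    by (elim order_trans) (intro mult_right_mono mult_left_mono; simp add: mult_right_mono)
  then show ?thesis using that[of C "min \<nu> \<mu>"] C assms(3) by simp
qed

lemma exp_decay_bound:
  assumes "exp_decay S m f" "0 \<le> K"
    and "\<And>s t. s \<in> S \<Longrightarrow> 0 \<le> t \<Longrightarrow> norm (g s t) \<le> K * norm (f s t)"
  shows "exp_decay S m g"
proof -
  obtain C \<nu> where C: "0 \<le> C" "0 < \<nu>"
    "\<And>s t. s \<in> S \<Longrightarrow> 0 \<le> t \<Longrightarrow> norm (f s t) \<le> C * exp (- \<nu> * t) * m s"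
    using assms(1) unfolding exp_decay_def by blast
  show ?thesis
  proof (rule exp_decayI[of "K * C" \<nu>])
    fix s t assume st: "s \<in> S" "0 \<le> (t::real)"
    have "norm (g s t) \<le> K * norm (f s t)" using assms(3) st .
    also have "\<dots> \<le> K * (C * exp (- \<nu> * t) * m s)" using C(3)[OF st] assms(2) by (rule mult_left_mono)
    finally show "norm (g s t) \<le> K * C * exp (- \<nu> * t) * m s" by (simp add: mult.assoc)
  qed (use C assms(2) in auto)
qed

lemma exp_decay_add:
  assumes "exp_decay S m f" "exp_decay S m g" and m: "\<And>s. s \<in> S \<Longrightarrow> 0 \<le> m s"
  shows "exp_decay S m (\<lambda>s t. f s t + g s t)"
proof -
  obtain C \<nu> where C: "0 \<le> C" "0 < \<nu>"
    "\<And>s t. s \<in> S \<Longrightarrow> 0 \<le> t \<Longrightarrow> norm (f s t) \<le> C * exp (- \<nu> * t) * m s"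
    using assms(1) unfolding exp_decay_def by blast
  obtain D \<mu> where D: "0 \<le> D" "0 < \<mu>" "\<mu> \<le> \<nu>"
    "\<And>s t. s \<in> S \<Longrightarrow> 0 \<le> t \<Longrightarrow> norm (g s t) \<le> D * exp (- \<mu> * t) * m s"
    using exp_decayE[OF assms(2) m C(2)] by blast
  show ?thesis
  proof (rule exp_decayI[of "C + D" \<mu>])
    fix s t assume st: "s \<in> S" "0 \<le> (t::real)"
    have "C * exp (- \<nu> * t) * m s \<le> C * exp (- \<mu> * t) * m s"
      using C(1) D(3) st m by (intro mult_right_mono mult_left_mono) (auto simp: mult_right_mono)
    then show "norm (f s t + g s t) \<le> (C + D) * exp (- \<mu> * t) * m s"
      using norm_triangle_ineq[of "f s t" "g s t"] C(3)[OF st] D(4)[OF st]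
      by (simp add: distrib_right)
  qed (use C D in auto)
qed

lemma exp_decay_sum:
  assumes "finite A" "\<And>k. k \<in> A \<Longrightarrow> exp_decay S m (f k)" and m: "\<And>s. s \<in> S \<Longrightarrow> 0 \<le> m s"
  shows "exp_decay S m (\<lambda>s t. \<Sum>k\<in>A. f k s t)"
  using assms(1,2)
proof (induction A)
  case empty
  show ?case by (rule exp_decayI[of 0 1]) auto
next
  case (insert k A)
  then have "exp_decay S m (\<lambda>s t. f k s t + (\<Sum>k\<in>A. f k s t))"
    by (intro exp_decay_add m) auto
  with insert show ?case by simp
qed

text \<open>The integrating factor \<open>exp (- \<rho> * t)\<close> removes the homogeneous term.
  What remains is the growth of a function whose derivative is
  \<open>exp (- \<rho> * t) * u s t\<close>, which the mean value inequality controls.\<close>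

lemma exp_decay_first_order:
  fixes w u :: "'s \<Rightarrow> real \<Rightarrow> complex"
  assumes lam: "Re \<rho> < 0" and u: "exp_decay S m u" and m: "\<And>s. s \<in> S \<Longrightarrow> 0 \<le> m s"
    and w: "\<And>s t. s \<in> S \<Longrightarrow> 0 \<le> t \<Longrightarrow>
      (w s has_vector_derivative \<rho> * w s t + u s t) (at t within {0..})"
    and K: "0 \<le> K" "\<And>s. s \<in> S \<Longrightarrow> norm (w s 0) \<le> K * m s"
  shows "exp_decay S m w"
proof -
  define \<mu> where "\<mu> = - Re \<rho>"
  have mu: "0 < \<mu>" using lam by (simp add: \<mu>_def)
  \<comment> \<open>Capping the rate of the input at half of \<open>\<mu>\<close> keeps
    \<open>\<mu> - \<nu>\<close> positive, which excludes resonance and permits division by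
    it.\<close>
  obtain C \<nu> where C: "0 \<le> C" "0 < \<nu>" "\<nu> \<le> \<mu> / 2"
    "\<And>s t. s \<in> S \<Longrightarrow> 0 \<le> t \<Longrightarrow> norm (u s t) \<le> C * exp (- \<nu> * t) * m s"
    using exp_decayE[OF u m, of "\<mu> / 2"] mu by (auto intro: that)
  have gap: "\<mu> - \<nu> > 0" using C mu by simp
  show ?thesis
  proof (rule exp_decayI[of "K + C / (\<mu> - \<nu>)" \<nu>])
    fix s and T :: real assume s: "s \<in> S" and T: "0 \<le> T"
    define f where "f = (\<lambda>t. exp (- \<rho> * of_real t) * w s t)"
    \<comment> \<open>An antiderivative of the bound
      \<open>C * m s * exp ((\<mu> - \<nu>) * t)\<close> on the norm of the derivative of
      \<open>f\<close>.\<close>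
    define \<phi> where "\<phi> = (\<lambda>t. C * m s / (\<mu> - \<nu>) * exp ((\<mu> - \<nu>) * t))"
    have f': "(f has_vector_derivative exp (- \<rho> * of_real t) * u s t) (at t within {0..})"
      if "0 \<le> t" for t
    proof -
      have "((\<lambda>t. exp (- \<rho> * of_real t)) has_vector_derivative - \<rho> * exp (- \<rho> * of_real t))
          (at t within {0..})"
        by (rule has_vector_derivative_real_field) (auto intro!: derivative_eq_intros)
      from has_vector_derivative_mult[OF this w[OF s that]]
      show ?thesis unfolding f_def by (simp add: algebra_simps)
    qed
    have phi': "(\<phi> has_vector_derivative C * m s * exp ((\<mu> - \<nu>) * t)) (at t)" for t
      unfolding \<phi>_def has_real_derivative_iff_has_vector_derivative[symmetric]
      using gap by (auto intro!: derivative_eq_intros)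
    have main: "norm (f T - f 0) \<le> \<phi> T - \<phi> 0"
    proof (cases "T = 0")
      case False
      show ?thesis
      proof (rule differentiable_bound_general)
        show "0 < T" using T False by simp
        show "continuous_on {0..T} f"
          by (rule continuous_on_vector_derivative, rule has_vector_derivative_within_subset[OF f'])
             auto
        show "continuous_on {0..T} \<phi>" unfolding \<phi>_def by (intro continuous_intros)
        fix x assume x: "0 < x" "x < T"
        have "at x within {0..} = at x" using x by (intro at_within_interior) simp
        then show "(f has_vector_derivative exp (- \<rho> * of_real x) * u s x) (at x)"
          using f'[of x] x by simp
        show "(\<phi> has_vector_derivative C * m s * exp ((\<mu> - \<nu>) * x)) (at x)" by (rule phi')
        have "norm (exp (- \<rho> * of_real x) * u s x) = exp (\<mu> * x) * norm (u s x)"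
          by (simp add: norm_mult \<mu>_def)
        also have "\<dots> \<le> exp (\<mu> * x) * (C * exp (- \<nu> * x) * m s)"
          using C(4)[OF s] x by (intro mult_left_mono) auto
        also have "\<dots> = C * m s * exp ((\<mu> - \<nu>) * x)"
          by (simp add: left_diff_distrib exp_diff exp_minus field_simps)
        finally show "norm (exp (- \<rho> * of_real x) * u s x) \<le> C * m s * exp ((\<mu> - \<nu>) * x)" .
      qed
    qed simp
    have pos: "0 \<le> C * m s / (\<mu> - \<nu>)" using C(1) m[OF s] gap by simp
    have "norm (f T) \<le> norm (f 0) + norm (f T - f 0)" using norm_triangle_sub by blast
    also have "\<dots> \<le> K * m s + \<phi> T"
      using main K(2)[OF s] pos unfolding f_def \<phi>_def by simp
    finally have "exp (- \<mu> * T) * norm (f T) \<le> exp (- \<mu> * T) * (K * m s + \<phi> T)"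
      by (rule mult_left_mono) simp
    moreover have "exp (- \<mu> * T) * norm (f T) = norm (w s T)"
      unfolding f_def by (simp add: norm_mult \<mu>_def flip: mult.assoc exp_add)
    moreover have "exp (- \<mu> * T) * \<phi> T = C * m s / (\<mu> - \<nu>) * exp (- \<nu> * T)"
      unfolding \<phi>_def by (simp add: left_diff_distrib exp_diff exp_minus field_simps)
    moreover have "exp (- \<mu> * T) * (K * m s) \<le> exp (- \<nu> * T) * (K * m s)"
      using K(1) m[OF s] gap T by (intro mult_right_mono) (auto simp: mult_right_mono)
    ultimately show "norm (w s T) \<le> (K + C / (\<mu> - \<nu>)) * exp (- \<nu> * T) * m s"
      by (simp add: algebra_simps)
  qed (use C K gap in auto)
qed

text \<open>With \<open>x\<close>, \<open>y\<close>, \<open>z\<close> the characteristic roots and D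
  the time derivative, the equation reads (D - x)(D - y)(D - z) z1 = u. It is solved as a cascade of
  three stable first-order equations, each driven by the output of the one before.\<close>

lemma exp_decay_third_order:
  fixes z1 z2 z3 u :: "'s \<Rightarrow> real \<Rightarrow> real"
  assumes RH: "a > 0" "c > 0" "a * b > c"
    and u: "exp_decay S m u" and m: "\<And>s. s \<in> S \<Longrightarrow> 0 \<le> m s"
    and d1: "\<And>s t. s \<in> S \<Longrightarrow> 0 \<le> t \<Longrightarrow> (z1 s has_vector_derivative z2 s t) (at t within {0..})"
    and d2: "\<And>s t. s \<in> S \<Longrightarrow> 0 \<le> t \<Longrightarrow> (z2 s has_vector_derivative z3 s t) (at t within {0..})"
    and d3: "\<And>s t. s \<in> S \<Longrightarrow> 0 \<le> t \<Longrightarrow>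
      (z3 s has_vector_derivative - c * z1 s t - b * z2 s t - a * z3 s t + u s t) (at t within {0..})"
    and init: "\<And>s. s \<in> S \<Longrightarrow> \<bar>z1 s 0\<bar> \<le> m s" "\<And>s. s \<in> S \<Longrightarrow> \<bar>z2 s 0\<bar> \<le> m s"
      "\<And>s. s \<in> S \<Longrightarrow> \<bar>z3 s 0\<bar> \<le> m s"
  shows "exp_decay S m z1" "exp_decay S m z2" "exp_decay S m z3"
proof -
  obtain x y z :: complex where abc: "of_real a = - (x + y + z)"
    "of_real b = x * y + y * z + z * x" "of_real c = - (x * y * z)"
    and Re: "Re x < 0" "Re y < 0" "Re z < 0"
    using cubic_roots_Routh_Hurwitz[of a b c] RH by metis
  note D = has_vector_derivative_of_real[OF iffD2[OF has_real_derivative_iff_has_vector_derivative]]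
  \<comment> \<open>The stages are w3 = z1, w2 = (D - z) z1 and w1 = (D - y)(D - z) z1; hence (D -
    x) w1 = u.\<close>
  define w1 where "w1 = (\<lambda>s t. of_real (z3 s t) - (y + z) * of_real (z2 s t) + y * z * of_real (z1 s t))"
  define w2 where "w2 = (\<lambda>s t. of_real (z2 s t) - z * of_real (z1 s t))"
  define w3 where "w3 = (\<lambda>s t. of_real (z1 s t) :: complex)"
  have scale: "exp_decay S m (\<lambda>s t. \<kappa> * f s t)" if "exp_decay S m f"
    for f :: "'s \<Rightarrow> real \<Rightarrow> complex" and \<kappa>
    by (rule exp_decay_bound[OF that, of "norm \<kappa>"]) (auto simp: norm_mult)
  have real: "exp_decay S m f" if "exp_decay S m (\<lambda>s t. of_real (f s t) :: complex)" for f
    by (rule exp_decay_bound[OF that, of 1]) auto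
  have u': "exp_decay S m (\<lambda>s t. of_real (u s t) :: complex)"
    by (rule exp_decay_bound[OF u, of 1]) auto
  have w1: "exp_decay S m w1"
  proof (rule exp_decay_first_order[OF Re(1) u' m])
    fix s t assume st: "s \<in> S" "0 \<le> (t::real)"
    have "(w1 s has_vector_derivative
        of_real (- c * z1 s t - b * z2 s t - a * z3 s t + u s t) - (y + z) * of_real (z3 s t)
          + y * z * of_real (z2 s t)) (at t within {0..})"
      unfolding w1_def
      by (intro has_vector_derivative_add has_vector_derivative_diff has_vector_derivative_mult_right
          D d1 d2 d3 st)
    also have "of_real (- c * z1 s t - b * z2 s t - a * z3 s t + u s t) - (y + z) * of_real (z3 s t)
          + y * z * of_real (z2 s t) = x * w1 s t + of_real (u s t)"
      by (simp add: w1_def abc algebra_simps)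
    finally show "(w1 s has_vector_derivative x * w1 s t + of_real (u s t)) (at t within {0..})" .
  next
    fix s assume s: "s \<in> S"
    have "norm (w1 s 0) \<le> norm (of_real (z3 s 0) - (y + z) * of_real (z2 s 0)) + norm (y * z * of_real (z1 s 0))"
      unfolding w1_def by (rule norm_triangle_ineq)
    also have "\<dots> \<le> (\<bar>z3 s 0\<bar> + norm (y + z) * \<bar>z2 s 0\<bar>) + norm (y * z) * \<bar>z1 s 0\<bar>"
      by (intro add_mono order_trans[OF norm_triangle_ineq4]) (auto simp: norm_mult)
    also have "\<dots> \<le> (m s + norm (y + z) * m s) + norm (y * z) * m s"
      using init s by (intro add_mono mult_left_mono) auto
    finally show "norm (w1 s 0) \<le> (1 + norm (y + z) + norm (y * z)) * m s"
      by (simp add: algebra_simps)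
  qed auto
  have w2: "exp_decay S m w2"
  proof (rule exp_decay_first_order[OF Re(2) w1 m])
    fix s t assume st: "s \<in> S" "0 \<le> (t::real)"
    have "(w2 s has_vector_derivative of_real (z3 s t) - z * of_real (z2 s t)) (at t within {0..})"
      unfolding w2_def
      by (intro has_vector_derivative_diff has_vector_derivative_mult_right D d1 d2 st)
    also have "of_real (z3 s t) - z * of_real (z2 s t) = y * w2 s t + w1 s t"
      by (simp add: w1_def w2_def algebra_simps)
    finally show "(w2 s has_vector_derivative y * w2 s t + w1 s t) (at t within {0..})" .
  next
    fix s assume s: "s \<in> S"
    have "norm (w2 s 0) \<le> \<bar>z2 s 0\<bar> + norm z * \<bar>z1 s 0\<bar>"
      unfolding w2_def by (rule order_trans[OF norm_triangle_ineq4]) (auto simp: norm_mult)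
    also have "\<dots> \<le> m s + norm z * m s"
      using init s by (intro add_mono mult_left_mono) auto
    finally show "norm (w2 s 0) \<le> (1 + norm z) * m s" by (simp add: algebra_simps)
  qed auto
  have w3: "exp_decay S m w3"
  proof (rule exp_decay_first_order[where K = 1, OF Re(3) w2 m])
    fix s t assume st: "s \<in> S" "0 \<le> (t::real)"
    show "(w3 s has_vector_derivative z * w3 s t + w2 s t) (at t within {0..})"
      using D[OF d1[OF st]] unfolding w3_def w2_def by simp
  next
    fix s assume "s \<in> S"
    then show "norm (w3 s 0) \<le> 1 * m s" using init(1)[of s] by (simp add: w3_def)
  qed simp_all
  show "exp_decay S m z1" using w3 unfolding w3_def by (rule real)
  \<comment> \<open>The definitions of the stages are inverted to recover first \<open>z2\<close>
    and then \<open>z3\<close>.\<close>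
  have "exp_decay S m (\<lambda>s t. w2 s t + z * w3 s t)" by (intro exp_decay_add scale w2 w3 m)
  then have z2: "exp_decay S m (\<lambda>s t. of_real (z2 s t) :: complex)" by (simp add: w2_def w3_def)
  then show "exp_decay S m z2" by (rule real)
  have "exp_decay S m (\<lambda>s t. w1 s t + ((y + z) * of_real (z2 s t) + (- (y * z)) * w3 s t))"
    by (intro exp_decay_add scale w1 w3 z2 m)
  then have "exp_decay S m (\<lambda>s t. of_real (z3 s t) :: complex)"
    by (simp add: w1_def w3_def algebra_simps)
  then show "exp_decay S m z3" by (rule real)
qed

subsection \<open>The closed loop on an acyclic topology\<close>

lemma has_vector_derivative_vec_iff:
  fixes f :: "real \<Rightarrow> real^'n"
  shows "(f has_vector_derivative f') (at t within S) \<longleftrightarrow>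
    (\<forall>i. ((\<lambda>t. f t $ i) has_vector_derivative f' $ i) (at t within S))"
  unfolding has_vector_derivative_def
  by (subst has_derivative_componentwise_within) (auto simp: Basis_vec_def inner_axis)

lemma Gmul_nth: "Gmul am pm x $ i = (deg am i + pm i) * x $ i - (\<Sum>j\<in>UNIV. am i j * x $ j)"
  by (simp add: Gmul_def deg_def right_diff_distrib sum_subtractf flip: sum_distrib_right)
    (simp add: algebra_simps)

locale acyclic_platoon =
  fixes tau kp kv ka :: "'n::finite \<Rightarrow> real"
    and cp cv ca :: real
    and am :: "'n \<Rightarrow> 'n \<Rightarrow> real" and pm :: "'n \<Rightarrow> real"
  assumes am01: "am i j \<in> {0, 1}"
    and acyclic_edges: "acyclic {(i, j). am i j = 1}"
begin

definition "edges = {(i, j). am i j = 1}"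

text \<open>Finiteness turns acyclicity into well-foundedness both ways. An edge runs from receiver
  to source, so here receivers lie below sources, which serves to choose an extremal follower. The
  converse puts sources below receivers and supports induction and recursion along the flow of
  information.\<close>

lemma wf_edges: "wf edges"
  using acyclic_edges by (auto simp: edges_def intro: finite_acyclic_wf)

lemma wf_edges_converse: "wf (edges\<inverse>)"
  using acyclic_edges by (auto simp: edges_def intro: finite_acyclic_wf_converse)

lemma am_zero: "(i, j) \<notin> edges \<Longrightarrow> am i j = 0"
  using am01[of i j] by (auto simp: edges_def)

text \<open>The diagonal entry of \<open>G\<close>; by acyclicity these entries are the eigenvalues
  of \<open>G\<close>.\<close>

definition "grounding i = deg am i + pm i"

text \<open>Decoupled from its in-neighbours, follower \<open>i\<close> has the characteristic polynomial
  \<open>s ^ 3 + char2 i * s ^ 2 + char1 i * s + char0 i\<close>.\<close>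

definition "char2 i = (1 + ka i * ca * grounding i) / tau i"
definition "char1 i = kv i * cv * grounding i / tau i"
definition "char0 i = kp i * cp * grounding i / tau i"

text \<open>Separates the own state of follower \<open>i\<close> from the input it receives, the
  shape shared by the decay estimate and the eigenmode equation.\<close>

lemma accel_eq:
  "- (kp i * cp / tau i) * Gmul am pm x $ i - (kv i * cv / tau i) * Gmul am pm y $ i
     - (1 / tau i) * z $ i - (ka i * ca / tau i) * Gmul am pm z $ i =
   - char0 i * x $ i - char1 i * y $ i - char2 i * z $ i +
     (\<Sum>j\<in>UNIV. am i j * (kp i * cp / tau i * x $ j + kv i * cv / tau i * y $ j + ka i * ca / tau i * z $ j))"
  (is "?L = ?R")
proof -
  have "(\<Sum>j\<in>UNIV. am i j * (kp i * cp / tau i * x $ j + kv i * cv / tau i * y $ j + ka i * ca / tau i * z $ j))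
    = kp i * cp / tau i * (\<Sum>j\<in>UNIV. am i j * x $ j) + kv i * cv / tau i * (\<Sum>j\<in>UNIV. am i j * y $ j)
      + ka i * ca / tau i * (\<Sum>j\<in>UNIV. am i j * z $ j)"
    by (simp add: sum_distrib_left flip: sum.distrib) (simp add: algebra_simps)
  moreover have "- \<alpha> / \<tau> * (g * x - X) - \<beta> / \<tau> * (g * y - Y) - 1 / \<tau> * z - \<gamma> / \<tau> * (g * z - Z) =
      - (\<alpha> * g / \<tau>) * x - \<beta> * g / \<tau> * y - (1 + \<gamma> * g) / \<tau> * z
      + (\<alpha> / \<tau> * X + \<beta> / \<tau> * Y + \<gamma> / \<tau> * Z)" for \<alpha> \<beta> \<gamma> \<tau> g x y z X Y Z :: real
    by (simp add: divide_inverse algebra_simps)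
  ultimately show ?thesis
    unfolding Gmul_nth char0_def char1_def char2_def grounding_def by simp
qed

text \<open>Exponential decay is proved follower by follower in the order of information flow. All
  solutions are treated as one family weighted by their initial norm, so the final constant does not
  depend on the solution.\<close>

lemma stable_if_Routh_Hurwitz:
  assumes RH: "\<And>i. char2 i > 0 \<and> char0 i > 0 \<and> char2 i * char1 i > char0 i"
  shows "asymptotically_stable tau kp kv ka cp cv ca am pm"
proof -
  define S where "S = {(p, v, a). is_solution tau kp kv ka cp cv ca am pm p v a}"
  define m where "m = (\<lambda>(p, v, a). norm (p (0::real) :: real^'n, v (0::real) :: real^'n, a (0::real) :: real^'n))"
  define P where "P = (\<lambda>(i::'n) (s :: (real \<Rightarrow> real^'n) \<times> (real \<Rightarrow> real^'n) \<times> (real \<Rightarrow> real^'n)) t. fst s t $ i)"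
  define V where "V = (\<lambda>(i::'n) (s :: (real \<Rightarrow> real^'n) \<times> (real \<Rightarrow> real^'n) \<times> (real \<Rightarrow> real^'n)) t. fst (snd s) t $ i)"
  define A where "A = (\<lambda>(i::'n) (s :: (real \<Rightarrow> real^'n) \<times> (real \<Rightarrow> real^'n) \<times> (real \<Rightarrow> real^'n)) t. snd (snd s) t $ i)"
  have m: "m s \<ge> 0" for s by (auto simp: m_def split: prod.split)
  have init: "\<bar>P i s 0\<bar> \<le> m s" "\<bar>V i s 0\<bar> \<le> m s" "\<bar>A i s 0\<bar> \<le> m s" for i s
  proof -
    obtain p v a where s: "s = (p, v, a)" by (cases s)
    have *: "norm (p 0) \<le> m s" "norm (v 0) \<le> m s" "norm (a 0) \<le> m s"
      unfolding s m_def by (auto simp: norm_Pair intro: real_le_rsqrt)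
    show "\<bar>P i s 0\<bar> \<le> m s" "\<bar>V i s 0\<bar> \<le> m s" "\<bar>A i s 0\<bar> \<le> m s"
      using * order_trans[OF component_le_norm_cart] by (auto simp: P_def V_def A_def s)
  qed
  have decay: "exp_decay S m (P i) \<and> exp_decay S m (V i) \<and> exp_decay S m (A i)" for i
    using wf_edges_converse
  proof (induction i)
    case (less i)
    define u where "u = (\<lambda>s t. \<Sum>j\<in>UNIV. am i j *
      (kp i * cp / tau i * P j s t + kv i * cv / tau i * V j s t + ka i * ca / tau i * A j s t))"
    have scale: "exp_decay S m (\<lambda>s t. \<kappa> * f s t)" if "exp_decay S m f" for f and \<kappa> :: real
      by (rule exp_decay_bound[OF that, of "\<bar>\<kappa>\<bar>"]) (auto simp: abs_mult)
    \<comment> \<open>The coupling is a finite sum; an in-neighbour contributes a decaying signal by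
      induction, any other follower contributes zero.\<close>
    have u: "exp_decay S m u"
      unfolding u_def
    proof (rule exp_decay_sum[OF _ _ m])
      fix j :: 'n
      show "exp_decay S m (\<lambda>s t. am i j *
        (kp i * cp / tau i * P j s t + kv i * cv / tau i * V j s t + ka i * ca / tau i * A j s t))"
      proof (cases "(i, j) \<in> edges")
        case True
        with less have "exp_decay S m (P j)" "exp_decay S m (V j)" "exp_decay S m (A j)" by auto
        then show ?thesis by (intro scale exp_decay_add m)
      next
        case False
        show ?thesis by (rule exp_decayI[of 0 1]) (auto simp: am_zero[OF False])
      qed
    qed simp
    have d1: "(P i s has_vector_derivative V i s t) (at t within {0..})"
      and d2: "(V i s has_vector_derivative A i s t) (at t within {0..})"
      and d3: "(A i s has_vector_derivative
        - char0 i * P i s t - char1 i * V i s t - char2 i * A i s t + u s t) (at t within {0..})"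
      if "s \<in> S" "0 \<le> t" for s t
    proof -
      obtain p v a where s: "s = (p, v, a)" by (cases s)
      with that(1) have "is_solution tau kp kv ka cp cv ca am pm p v a" by (simp add: S_def)
      with that(2) show "(P i s has_vector_derivative V i s t) (at t within {0..})"
        "(V i s has_vector_derivative A i s t) (at t within {0..})"
        "(A i s has_vector_derivative
          - char0 i * P i s t - char1 i * V i s t - char2 i * A i s t + u s t) (at t within {0..})"
        unfolding is_solution_def has_vector_derivative_vec_iff vec_lambda_beta accel_eq
          s P_def V_def A_def u_def fst_conv snd_conv by blast+
    qed
    show ?case
      using exp_decay_third_order[OF _ _ _ u m d1 d2 d3 init] RH[of i] by blast
  qed
  have norm_bound: "norm (p t, v t, a t) \<le> (\<Sum>i\<in>UNIV. \<bar>P i (p, v, a) t\<bar> + \<bar>V i (p, v, a) t\<bar> + \<bar>A i (p, v, a) t\<bar>)"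
    for p v a t
  proof -
    have "norm (p t, v t, a t) \<le> norm (p t) + (norm (v t) + norm (a t))"
      by (intro order_trans[OF norm_Pair_le] add_left_mono norm_Pair_le)
    also have "\<dots> \<le> (\<Sum>i\<in>UNIV. \<bar>p t $ i\<bar>) + ((\<Sum>i\<in>UNIV. \<bar>v t $ i\<bar>) + (\<Sum>i\<in>UNIV. \<bar>a t $ i\<bar>))"
      by (intro add_mono norm_le_l1_cart)
    finally show ?thesis by (simp add: P_def V_def A_def sum.distrib)
  qed
  have abs: "exp_decay S m (\<lambda>s t. \<bar>f s t\<bar>)" if "exp_decay S m f" for f :: "_ \<Rightarrow> real \<Rightarrow> real"
    by (rule exp_decay_bound[OF that, of 1]) auto
  have "exp_decay S m (\<lambda>s t. \<Sum>i\<in>UNIV. \<bar>P i s t\<bar> + \<bar>V i s t\<bar> + \<bar>A i s t\<bar>)"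
    using decay by (intro exp_decay_sum exp_decay_add abs m) auto
  then obtain C \<nu> where C: "0 \<le> C" "0 < \<nu>"
    "\<And>s t. s \<in> S \<Longrightarrow> 0 \<le> t \<Longrightarrow>
      norm (\<Sum>i\<in>UNIV. \<bar>P i s t\<bar> + \<bar>V i s t\<bar> + \<bar>A i s t\<bar>) \<le> C * exp (- \<nu> * t) * m s"
    unfolding exp_decay_def by blast
  have main: "norm (p t, v t, a t) \<le> C * exp (- \<nu> * t) * norm (p 0, v 0, a 0)"
    if "is_solution tau kp kv ka cp cv ca am pm p v a" "0 \<le> t" for p v a t
    using norm_bound[of p t v a] C(3)[of "(p, v, a)" t] that by (auto simp: S_def m_def)
  show ?thesis
    unfolding asymptotically_stable_def
  proof (intro conjI allI impI)
    fix e :: real assume e: "e > 0"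
    show "\<exists>d>0. \<forall>p v a. is_solution tau kp kv ka cp cv ca am pm p v a \<longrightarrow>
         norm (p 0, v 0, a 0) < d \<longrightarrow> (\<forall>t\<ge>0. norm (p t, v t, a t) < e)"
    \<comment> \<open>Dividing by \<open>C + 1\<close> instead of \<open>C\<close> covers the case
      \<open>C = 0\<close>.\<close>
    proof (intro exI[of _ "e / (C + 1)"] conjI allI impI)
      fix p v a and t :: real
      assume sol: "is_solution tau kp kv ka cp cv ca am pm p v a"
        and d: "norm (p 0, v 0, a 0) < e / (C + 1)" and t: "0 \<le> t"
      have "norm (p t, v t, a t) \<le> C * exp (- \<nu> * t) * norm (p 0, v 0, a 0)" using main[OF sol t] .
      also have "\<dots> \<le> C * 1 * norm (p 0, v 0, a 0)"
        using C t by (intro mult_right_mono mult_left_mono) auto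
      also have "\<dots> \<le> (C + 1) * norm (p 0, v 0, a 0)" by (simp add: distrib_right)
      also have "\<dots> < e" using d C by (simp add: field_simps)
      finally show "norm (p t, v t, a t) < e" .
    qed (use e C in auto)
  next
    fix p v a assume sol: "is_solution tau kp kv ka cp cv ca am pm p v a"
    have "((\<lambda>t. exp (- \<nu> * t)) \<longlongrightarrow> 0) at_top"
      by (rule filterlim_compose[OF exp_at_bot
            filterlim_tendsto_neg_mult_at_bot[OF tendsto_const _ filterlim_ident]]) (use C(2) in simp)
    then have "((\<lambda>t. C * exp (- \<nu> * t) * norm (p 0, v 0, a 0)) \<longlongrightarrow> 0) at_top"
      using tendsto_mult_right_zero tendsto_mult_left_zero by blast
    moreover have "eventually (\<lambda>t. norm (p t, v t, a t) \<le> C * exp (- \<nu> * t) * norm (p 0, v 0, a 0)) at_top"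
      using main[OF sol] by (auto intro: eventually_at_top_linorderI[of 0])
    ultimately show "((\<lambda>t. (p t, v t, a t)) \<longlongrightarrow> 0) at_top" by (rule Lim_null_comparison[rotated])
  qed
qed

text \<open>A root of follower \<open>i\<close>'s polynomial is an eigenvalue of the whole system. Among the followers
  sharing it, take one with no other such follower downstream: then the amplitude can be prescribed
  there, and the equations downstream are solvable one at a time.\<close>

lemma eigenmode:
  fixes \<rho> :: complex
  assumes "\<rho>^3 + char2 i0 * \<rho>^2 + char1 i0 * \<rho> + char0 i0 = 0"
  obtains x :: "'n \<Rightarrow> complex" and i where "x i = 1"
    "\<And>k. \<rho>^3 * x k = - char0 k * x k - char1 k * (\<rho> * x k) - char2 k * (\<rho>^2 * x k) +
      (\<Sum>j\<in>UNIV. am k j * (kp k * cp / tau k * x j + kv k * cv / tau k * (\<rho> * x j) +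
        ka k * ca / tau k * (\<rho>^2 * x j)))"
proof -
  define q where "q = (\<lambda>k. \<rho>^3 + char2 k * \<rho>^2 + char1 k * \<rho> + char0 k)"
  define b where "b = (\<lambda>k. of_real (kp k * cp / tau k) + of_real (kv k * cv / tau k) * \<rho>
    + of_real (ka k * ca / tau k) * \<rho>^2)"
  have "i0 \<in> {k. q k = 0}" using assms by (simp add: q_def)
  \<comment> \<open>Minimality for \<open>edges\<^sup>+\<close>:
    \<open>(k, i) \<in> edges\<^sup>+\<close> says that \<open>k\<close> lies downstream of
    \<open>i\<close>, and no such \<open>k\<close> shares the root.\<close>
  then obtain i where "i \<in> {k. q k = 0}" "\<And>k. (k, i) \<in> edges\<^sup>+ \<Longrightarrow> k \<notin> {k. q k = 0}"
    using wfE_min[OF wf_trancl[OF wf_edges]] by metis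
  then have i: "q i = 0" and downstream: "\<And>k. (k, i) \<in> edges\<^sup>+ \<Longrightarrow> q k \<noteq> 0"
    by simp_all
  \<comment> \<open>Away from \<open>i\<close> this solves
    \<open>q k * x k = b k * (\<Sum>j. am k j * x j)\<close> for \<open>x k\<close>. If
    \<open>q k = 0\<close>, division by zero sets \<open>x k\<close> to 0, which is consistent
    because the sum is shown to vanish there.\<close>
  define F where "F = (\<lambda>f k. if k = i then 1 else b k / q k * (\<Sum>j\<in>UNIV. of_real (am k j) * f j))"
  define x where "x = wfrec (edges\<inverse>) F"
  have x: "x k = F x k" for k
  proof -
    have "x k = F (cut x (edges\<inverse>) k) k" unfolding x_def by (rule wfrec[OF wf_edges_converse])
    \<comment> \<open>The truncation in well-founded recursion only affects non-neighbours, whose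
      coefficient is zero.\<close>
    moreover have "of_real (am k j) * cut x (edges\<inverse>) k j = of_real (am k j) * x j" for j
      by (cases "(k, j) \<in> edges") (auto simp: cut_apply am_zero)
    then have "(\<Sum>j\<in>UNIV. of_real (am k j) * cut x (edges\<inverse>) k j) = (\<Sum>j\<in>UNIV. of_real (am k j) * x j)"
      by (intro sum.cong) simp_all
    ultimately show ?thesis by (simp add: F_def)
  qed
  have neighbour: "\<exists>j. (k, j) \<in> edges \<and> x j \<noteq> 0" if "(\<Sum>j\<in>UNIV. of_real (am k j) * x j) \<noteq> 0" for k
  proof (rule ccontr)
    assume "\<not> ?thesis"
    then have "of_real (am k j) * x j = 0" for j using am_zero[of k j] by auto
    then have "(\<Sum>j\<in>UNIV. of_real (am k j) * x j) = 0" by (intro sum.neutral) simp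
    with that show False by contradiction
  qed
  \<comment> \<open>The mode lives only on \<open>i\<close> and the followers downstream of
    it.\<close>
  have support: "x k \<noteq> 0 \<longrightarrow> k = i \<or> (k, i) \<in> edges\<^sup>+" for k
    using wf_edges_converse
  proof (induction k)
    case (less k)
    show ?case
    proof (intro impI)
      assume nz: "x k \<noteq> 0"
      show "k = i \<or> (k, i) \<in> edges\<^sup>+"
      proof (cases "k = i")
        case False
        then have "x k = b k / q k * (\<Sum>j\<in>UNIV. of_real (am k j) * x j)"
          by (subst x) (simp add: F_def)
        with nz have "(\<Sum>j\<in>UNIV. of_real (am k j) * x j) \<noteq> 0" by (metis mult_zero_right)
        from neighbour[OF this] obtain j where j: "(k, j) \<in> edges" "x j \<noteq> 0" by blast
        with less[of j] have "j = i \<or> (j, i) \<in> edges\<^sup>+" by simp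
        with j(1) show ?thesis by (blast intro: trancl_into_trancl2)
      qed simp
    qed
  qed
  have "q k * x k = b k * (\<Sum>j\<in>UNIV. of_real (am k j) * x j)" for k
  proof (cases "q k = 0")
    case True
    \<comment> \<open>A nonzero input would place \<open>k\<close> strictly downstream of
      \<open>i\<close>, where \<open>q\<close> has no zero. This includes \<open>k = i\<close>,
      whose prescribed amplitude is thereby compatible with its equation.\<close>
    have "(\<Sum>j\<in>UNIV. of_real (am k j) * x j) = 0"
    proof (rule ccontr)
      assume "(\<Sum>j\<in>UNIV. of_real (am k j) * x j) \<noteq> 0"
      from neighbour[OF this] obtain j where "(k, j) \<in> edges" "x j \<noteq> 0" by blast
      with support[of j] have "(k, i) \<in> edges\<^sup>+" by (blast intro: trancl_into_trancl2)
      with downstream True show False by blast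
    qed
    with True show ?thesis by simp
  next
    case False
    with i have "k \<noteq> i" by auto
    then have "x k = b k / q k * (\<Sum>j\<in>UNIV. of_real (am k j) * x j)"
      by (subst x) (simp add: F_def)
    with False show ?thesis by simp
  qed
  then have eq: "q k * x k = (\<Sum>j\<in>UNIV. of_real (am k j) * (b k * x j))" for k
    by (simp add: sum_distrib_left mult.left_commute)
  show ?thesis
  proof (rule that[of x i])
    show "x i = 1" using x[of i] by (simp add: F_def)
    fix k
    have "of_real (kp k * cp / tau k) * y + of_real (kv k * cv / tau k) * (\<rho> * y) +
        of_real (ka k * ca / tau k) * (\<rho>^2 * y) = b k * y" for y
      by (simp only: b_def distrib_right mult.assoc)
    then show "\<rho>^3 * x k = - char0 k * x k - char1 k * (\<rho> * x k) - char2 k * (\<rho>^2 * x k) +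
      (\<Sum>j\<in>UNIV. am k j * (kp k * cp / tau k * x j + kv k * cv / tau k * (\<rho> * x j) +
        ka k * ca / tau k * (\<rho>^2 * x j)))"
      by (simp only: eq[symmetric]) (simp add: q_def algebra_simps)
  qed
qed

text \<open>Sampled at multiples of the period of the oscillation, the cosine factor is 1 and the
  values stay at least 1.\<close>

lemma Re_cexp_not_tendsto_0:
  assumes "Re \<rho> \<ge> 0"
  shows "\<not> ((\<lambda>t. Re (exp (\<rho> * of_real t))) \<longlongrightarrow> 0) at_top"
proof
  assume lim: "((\<lambda>t. Re (exp (\<rho> * of_real t))) \<longlongrightarrow> 0) at_top"
  \<comment> \<open>Without oscillation any positive step works, and 1 is taken.\<close>
  define T where "T = (if Im \<rho> = 0 then 1 else 2 * pi / \<bar>Im \<rho>\<bar>)"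
  have T: "T > 0" by (simp add: T_def)
  have "filterlim (\<lambda>n. T * real n) at_top sequentially"
    by (rule filterlim_tendsto_pos_mult_at_top[OF tendsto_const T filterlim_real_sequentially])
  from filterlim_compose[OF lim this] have lim': "(\<lambda>n. Re (exp (\<rho> * of_real (T * real n)))) \<longlonglongrightarrow> 0" .
  have "Re (exp (\<rho> * of_real (T * real n))) \<ge> 1" for n
  proof -
    have "cos (Im \<rho> * (T * real n)) = 1"
    proof (cases "Im \<rho> > 0")
      case True
      then have "Im \<rho> * (T * real n) = 2 * real n * pi" by (simp add: T_def)
      then show ?thesis by (simp only: cos_2npi)
    next
      case False
      then have "Im \<rho> = 0 \<or> Im \<rho> * (T * real n) = - (2 * real n * pi)" by (auto simp: T_def)
      then show ?thesis by (metis cos_2npi cos_minus cos_zero mult_zero_left)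
    qed
    moreover have "exp (Re \<rho> * (T * real n)) \<ge> 1" using assms T by simp
    ultimately show ?thesis by (simp add: Re_exp)
  qed
  then have "1 \<le> (0::real)" by (intro LIMSEQ_le_const[OF lim']) auto
  then show False by simp
qed

text \<open>Since the coefficients are real, the real part of the complex eigenmode is a genuine
  solution. Its position component \<open>i\<close> equals \<open>Re (exp (\<rho> * t))\<close>, so
  attractivity fails.\<close>

lemma not_stable_if_root:
  fixes \<rho> :: complex
  assumes root: "\<rho>^3 + char2 i0 * \<rho>^2 + char1 i0 * \<rho> + char0 i0 = 0" and Re: "Re \<rho> \<ge> 0"
  shows "\<not> asymptotically_stable tau kp kv ka cp cv ca am pm"
proof
  assume stable: "asymptotically_stable tau kp kv ka cp cv ca am pm"
  obtain x :: "'n \<Rightarrow> complex" and i where xi: "x i = 1" and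
    x: "\<And>k. \<rho>^3 * x k = - char0 k * x k - char1 k * (\<rho> * x k) - char2 k * (\<rho>^2 * x k) +
      (\<Sum>j\<in>UNIV. am k j * (kp k * cp / tau k * x j + kv k * cv / tau k * (\<rho> * x j) +
        ka k * ca / tau k * (\<rho>^2 * x j)))"
    using eigenmode[OF root] by blast
  \<comment> \<open>\<open>y n\<close> is the \<open>n\<close>-th time derivative of the position
    mode, so one formula yields position, velocity and acceleration.\<close>
  define y where "y = (\<lambda>n t. \<chi> k. Re (exp (\<rho> * of_real t) * (\<rho>^n * x k)))"
  have y': "(y n has_vector_derivative y (Suc n) t) (at t within {0..})" for n t
  proof -
    have "((\<lambda>t. exp (\<rho> * of_real t)) has_vector_derivative \<rho> * exp (\<rho> * of_real t))
        (at t within {0..})"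
      by (rule has_vector_derivative_real_field) (auto intro!: derivative_eq_intros)
    then have "((\<lambda>t. Re (exp (\<rho> * of_real t) * (\<rho>^n * x k))) has_vector_derivative
        Re (\<rho> * exp (\<rho> * of_real t) * (\<rho>^n * x k))) (at t within {0..})" for k
      by (intro bounded_linear.has_vector_derivative[OF bounded_linear_Re]
          has_vector_derivative_mult_left)
    moreover have "\<rho> * exp (\<rho> * of_real t) * (\<rho>^n * x k) = exp (\<rho> * of_real t) * (\<rho>^Suc n * x k)" for k
      by simp
    ultimately show ?thesis
      unfolding has_vector_derivative_vec_iff y_def vec_lambda_beta by metis
  qed
  have y3: "y 3 t $ k = - char0 k * y 0 t $ k - char1 k * y 1 t $ k - char2 k * y 2 t $ k +
     (\<Sum>j\<in>UNIV. am k j * (kp k * cp / tau k * y 0 t $ j + kv k * cv / tau k * y 1 t $ j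
       + ka k * ca / tau k * y 2 t $ j))" for t k
  proof -
    have Re_scale: "Re (of_real r * w) = r * Re w" for r w by simp
    define E where "E = exp (\<rho> * of_real t)"
    have "E * (\<rho>^3 * x k) = - of_real (char0 k) * (E * (\<rho>^0 * x k)) - of_real (char1 k) * (E * (\<rho>^1 * x k))
       - of_real (char2 k) * (E * (\<rho>^2 * x k)) +
      (\<Sum>j\<in>UNIV. of_real (am k j) * (of_real (kp k * cp / tau k) * (E * (\<rho>^0 * x j))
        + of_real (kv k * cv / tau k) * (E * (\<rho>^1 * x j)) +
        of_real (ka k * ca / tau k) * (E * (\<rho>^2 * x j))))"
      unfolding x by (simp add: algebra_simps sum_distrib_left sum.distrib)
    from arg_cong[OF this, of Re] show ?thesis
      by (simp only: y_def E_def[symmetric] vec_lambda_beta plus_complex.sel minus_complex.sel Re_sum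
          Re_scale uminus_complex.sel mult_minus_left)
  qed
  have "is_solution tau kp kv ka cp cv ca am pm (y 0) (y 1) (y 2)"
    unfolding is_solution_def accel_eq y3[symmetric]
    using y'[of 0] y'[of 1] y'[of 2] by (simp add: numeral_2_eq_2 numeral_3_eq_3)
  then have "((\<lambda>t. (y 0 t, y 1 t, y 2 t)) \<longlongrightarrow> 0) at_top"
    using stable unfolding asymptotically_stable_def by blast
  then have "((\<lambda>t. fst (y 0 t, y 1 t, y 2 t) $ i) \<longlongrightarrow> fst (0 :: (real^'n) \<times> (real^'n) \<times> (real^'n)) $ i) at_top"
    by (intro tendsto_vec_nth tendsto_fst)
  then show False
    using Re_cexp_not_tendsto_0[OF Re] by (simp add: y_def xi)
qed

lemma stable_iff_Routh_Hurwitz: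
  "asymptotically_stable tau kp kv ka cp cv ca am pm \<longleftrightarrow>
    (\<forall>i. char2 i > 0 \<and> char0 i > 0 \<and> char2 i * char1 i > char0 i)"
proof
  assume stable: "asymptotically_stable tau kp kv ka cp cv ca am pm"
  show "\<forall>i. char2 i > 0 \<and> char0 i > 0 \<and> char2 i * char1 i > char0 i"
  proof
    fix i
    obtain x y z :: complex where abc: "of_real (char2 i) = - (x + y + z)"
      "of_real (char1 i) = x * y + y * z + z * x" "of_real (char0 i) = - (x * y * z)"
      and RH: "Re x < 0 \<and> Re y < 0 \<and> Re z < 0 \<longleftrightarrow>
        char2 i > 0 \<and> char0 i > 0 \<and> char2 i * char1 i > char0 i"
      by (rule cubic_roots_Routh_Hurwitz)
    have "Re s < 0" if "s \<in> {x, y, z}" for s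
    proof (rule ccontr)
      assume "\<not> Re s < 0"
      \<comment> \<open>The Vieta relations make \<open>x\<close>, \<open>y\<close>,
        \<open>z\<close> the roots, so an unstable one would contradict stability.\<close>
      moreover have "s^3 + char2 i * s^2 + char1 i * s + char0 i = (s - x) * (s - y) * (s - z)"
        unfolding abc by (simp add: algebra_simps power2_eq_square power3_eq_cube)
      then have "s^3 + char2 i * s^2 + char1 i * s + char0 i = 0" using that by auto
      ultimately show False using not_stable_if_root stable by fastforce
    qed
    then show "char2 i > 0 \<and> char0 i > 0 \<and> char2 i * char1 i > char0 i" using RH by blast
  qed
qed (use stable_if_Routh_Hurwitz in blast)

end

text \<open>With \<open>g = 0\<close> both sides are false, so the junk value of \<open>- 1 / g\<close> does no harm.\<close>

lemma Routh_Hurwitz_gain_conditions: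
  fixes \<tau> kp kv k cp cv g :: real
  assumes "\<tau> > 0" "g \<ge> 0" "cp \<in> {0, 1}" "cv \<in> {0, 1}"
  shows "((1 + k * g) / \<tau> > 0 \<and> kp * cp * g / \<tau> > 0 \<and>
      (1 + k * g) / \<tau> * (kv * cv * g / \<tau>) > kp * cp * g / \<tau>) \<longleftrightarrow>
    cp = 1 \<and> cv = 1 \<and> g > 0 \<and> kp > 0 \<and> kv > \<tau> * kp / (1 + k * g) \<and> k > - 1 / g"
\<comment> \<open>These three conditions follow from either side; when one of them fails, both sides
  are false.\<close>
proof (cases "cp = 1 \<and> g > 0 \<and> 1 + k * g > 0")
  case True
  then have g: "g > 0" and pos: "1 + k * g > 0" by auto
  have "(1 + k * g) / \<tau> * (kv * cv * g / \<tau>) > kp * cp * g / \<tau> \<longleftrightarrow>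
      (1 + k * g) * (kv * cv) > \<tau> * kp"
  proof -
    \<comment> \<open>Both sides carry the positive factor \<open>g / \<tau>^2\<close>, which
      cancels.\<close>
    have "(1 + k * g) / \<tau> * (kv * cv * g / \<tau>) = g / \<tau>^2 * ((1 + k * g) * (kv * cv))"
      and "kp * cp * g / \<tau> = g / \<tau>^2 * (\<tau> * kp)"
      using True assms(1) by (simp_all add: power2_eq_square)
    moreover have "g / \<tau>^2 > 0" using g assms(1) by simp
    ultimately show ?thesis by (simp only: mult_less_cancel_left_pos)
  qed
  moreover have "kv > \<tau> * kp / (1 + k * g) \<longleftrightarrow> (1 + k * g) * kv > \<tau> * kp"
    using pos by (simp add: pos_divide_less_eq mult.commute)
  \<comment> \<open>This rules out \<open>cv = 0\<close>, for which the inequality would read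
    \<open>0 > \<tau> * kp\<close>.\<close>
  moreover have "\<not> \<tau> * kp < 0" if "kp > 0" using assms(1) that by (simp add: mult_less_0_iff)
  moreover have "k > - 1 / g" using g pos by (simp add: field_simps)
  ultimately show ?thesis using True assms by (auto simp: zero_less_mult_iff zero_less_divide_iff)
next
  case False
  have "k > - 1 / g \<longleftrightarrow> 1 + k * g > 0" if "g > 0"
  proof -
    have "1 + k * g = g * (k - - 1 / g)" using that by (simp add: field_simps)
    then show ?thesis using that by (simp only: zero_less_mult_iff) auto
  qed
  then show ?thesis using False assms by (auto simp: zero_less_divide_iff)
qed

theorem theorem2:
  fixes tau kp kv ka :: "'n::finite \<Rightarrow> real"
    and cp cv ca :: real
    and am :: "'n \<Rightarrow> 'n \<Rightarrow> real" and pm :: "'n \<Rightarrow> real"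
  assumes tau_pos: "\<And>i. tau i > 0"
    and c01: "cp \<in> {0, 1}" "cv \<in> {0, 1}" "ca \<in> {0, 1}"
    and am01: "\<And>i j. am i j \<in> {0, 1}"
    and am_irrefl: "\<And>i. am i i = 0"
    and pm01: "\<And>i. pm i \<in> {0, 1}"
    and dag: "acyclic {(i, j). am i j = 1}"
  shows "asymptotically_stable tau kp kv ka cp cv ca am pm \<longleftrightarrow>
           (cp = 1 \<and> cv = 1) \<and>
           (\<forall>i. deg am i + pm i > 0) \<and>
           (\<forall>i. kp i > 0 \<and>
                kv i > tau i * kp i / (1 + ka i * ca * (deg am i + pm i)) \<and>
                ka i * ca > - 1 / (deg am i + pm i))"
proof -
  interpret acyclic_platoon tau kp kv ka cp cv ca am pm
    by unfold_locales (use am01 dag in auto)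
  \<comment> \<open>The sign analysis of the gains presupposes a nonnegative diagonal entry of
    \<open>G\<close>.\<close>
  have nonneg: "deg am i + pm i \<ge> 0" for i
  proof -
    have "am i j \<ge> 0" for j using am01[of i j] by auto
    then show ?thesis using pm01[of i] by (auto simp: deg_def intro!: add_nonneg_nonneg sum_nonneg)
  qed
  show ?thesis
    unfolding stable_iff_Routh_Hurwitz char0_def char1_def char2_def grounding_def
      Routh_Hurwitz_gain_conditions[OF tau_pos nonneg c01(1,2)]
    by blast
qed

end
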